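(* Let $\nu$ be a (real or complex) parameter and let $N\in\mathbb{N}\cup\{0\}$. For every integer $l$ with $1\le l\le\left[\frac{N-1}{2}\right]$, $$a_{N-2l}(N,\nu)=(-\nu)^{l}\sum_{i_{l}=1}^{N-2l+1}\ \sum_{i_{l-1}=1}^{i_{l}+1}\cdots\sum_{i_{1}=1}^{i_{2}+1}i_{l}\,i_{l-1}\cdots i_{1}.$$ Also, for every integer $l$ with $1\le l\le\left[\frac{N}{2}\right]$, $$a_{N-(2l-1)}(N,\nu)=0.$$
   Context: $[y]$ denotes the greatest integer not exceeding $y$. In the iterated sum, there are $l$ nested summations: $i_l$ ranges over $1,\dots,N-2l+1$, and for $1\le j\le l-1$ the index $i_j$ ranges over $1,\dots,i_{j+1}+1$ (for $l=1$ the sum is simply $\sum_{i_1=1}^{N-1}i_1$). The coefficients $a_i(N,\nu)$ ($N\in\mathbb{N}\cup\{0\}$, $0\le i\le N$) are defined recursively by: $a_N(N,\nu)=1$ for $N\ge 0$; $a_{N-1}(N,\nu)=0$ for $N\ge 1$; $a_0(N,\nu)=-\nu\,a_1(N-1,\nu)$ for $N\ge 2$; and $a_i(N,\nu)=-(i+1)\,\nu\,a_{i+1}(N-1,\nu)+a_{i-1}(N-1,\nu)$ for $1\le i\le N-2$. (They are the coefficients in $\left(\frac{d}{dt}\right)^N F=\left(\sum_{i=0}^N a_i(N,\nu)(x-\nu t)^i\right)F$ for $F=e^{xt-\nu t^2/2}$.) *)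

theory Defs
  imports Complex_Main
begin

text \<open>
  The coefficient $a_i(N,\nu)$ is \<^term>\<open>a_coeff i N \<nu>\<close>.  The class \<^class>\<open>real_normed_field\<close>
  covers both the real and the complex numbers.  For \<open>i > N\<close>, where the coefficient is not
  defined mathematically, the value is set to \<open>0\<close>; the recursion never uses such a value.
\<close>

fun a_coeff :: "nat \<Rightarrow> nat \<Rightarrow> 'a::real_normed_field \<Rightarrow> 'a" where
  "a_coeff i 0 \<nu> = (if i = 0 then 1 else 0)"
| "a_coeff i (Suc N) \<nu> =
    (if i > Suc N then 0
     else if i = Suc N then 1
     else if i = N then 0
     else if i = 0 then - \<nu> * a_coeff 1 N \<nu>
     else - of_nat (i + 1) * \<nu> * a_coeff (i + 1) N \<nu> + a_coeff (i - 1) N \<nu>)"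

lemma a_coeff_top: "a_coeff N N \<nu> = 1"
  by (cases N) auto

lemma a_coeff_subtop: "N \<ge> 1 \<Longrightarrow> a_coeff (N - 1) N \<nu> = 0"
  by (cases N) auto

lemma a_coeff_zero: "N \<ge> 2 \<Longrightarrow> a_coeff 0 N \<nu> = - \<nu> * a_coeff 1 (N - 1) \<nu>"
  by (cases N) auto

lemma a_coeff_step:
  "1 \<le> i \<Longrightarrow> i + 2 \<le> N \<Longrightarrow>
    a_coeff i N \<nu> = - of_nat (i + 1) * \<nu> * a_coeff (i + 1) (N - 1) \<nu> + a_coeff (i - 1) (N - 1) \<nu>"
  by (cases N) auto

text \<open>
  \<open>nested_sum l m f\<close> is the sum of $f(i_l, \dots, i_1)$ taken over $i_l = 1, \dots, m$,
  then $i_{l-1} = 1, \dots, i_l + 1$, and so on down to $i_1 = 1, \dots, i_2 + 1$.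
  The index tuple is the list with the outermost index $i_l$ first.
\<close>

fun nested_sum :: "nat \<Rightarrow> nat \<Rightarrow> (nat list \<Rightarrow> 'a::comm_monoid_add) \<Rightarrow> 'a" where
  "nested_sum 0 m f = f []"
| "nested_sum (Suc l) m f = (\<Sum>i=1..m. nested_sum l (i + 1) (\<lambda>is. f (i # is)))"

lemma nested_sum_1: "nested_sum 1 m f = (\<Sum>i=1..m. f [i])"
  by simp

lemma nested_sum_3:
  "nested_sum 3 m f = (\<Sum>i\<^sub>3=1..m. \<Sum>i\<^sub>2=1..i\<^sub>3+1. \<Sum>i\<^sub>1=1..i\<^sub>2+1. f [i\<^sub>3, i\<^sub>2, i\<^sub>1])"
  by (simp add: numeral_3_eq_3)

end

theory Submission
  imports Defs
begin

text \<open>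
  Write $S_l(m)$ for the nested sum of \<open>l\<close> indices with outer bound $m$; the claim is that
  $a_n(n + 2l, \nu) = (-\nu)^l S_l(n + 1)$.  Splitting the outermost sum of $S_{l+1}(n+1)$ at its
  last index $i_{l+1} = n + 1$ gives
  $$S_{l+1}(n+1) = S_{l+1}(n) + (n+1)\, S_l(n+2).$$
  Multiplied by $(-\nu)^{l+1}$, this is exactly the recursion that expresses the coefficient
  $a_n$ at level $n + 2(l+1)$ by $a_{n-1}$ at level $(n-1) + 2(l+1)$ and $a_{n+1}$ at level
  $(n+1) + 2l$.  The two sides also start from the same values: $S_0(n+1) = 1$ matches
  $a_n(n,\nu) = 1$, and $S_{l+1}(0) = 0$ matches the missing $a_{-1}$ in the recursion for $a_0$.
  So a double induction, on $l$ and then on $n$, proves the formula.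

  The recursion changes $N - i$ by $0$ or $2$, so it never mixes even and odd offsets.  On the odd
  side every coefficient is a combination of coefficients $a_n(n+1,\nu) = 0$, and hence vanishes.
\<close>

lemma nested_sum_mult_left:
  fixes c :: "'a::comm_semiring_0"
  shows "nested_sum l m (\<lambda>is. c * f is) = c * nested_sum l m f"
proof (induction l arbitrary: m f)
  case (Suc l)
  then show ?case by (simp add: sum_distrib_left)
qed simp

lemma nested_sum_prod_list_Suc:
  "nested_sum (Suc l) m (\<lambda>is. of_nat (prod_list is)) =
     (\<Sum>i=1..m. of_nat i * (nested_sum l (i + 1) (\<lambda>is. of_nat (prod_list is)) :: 'a::comm_semiring_1))"
  by (simp add: nested_sum_mult_left)

text \<open>
  The split of the outermost sum at its last index, which mirrors the recursion of the
  coefficients.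
\<close>

lemma nested_sum_prod_list_Suc_Suc:
  "nested_sum (Suc l) (Suc m) (\<lambda>is. of_nat (prod_list is)) =
     nested_sum (Suc l) m (\<lambda>is. of_nat (prod_list is)) +
     of_nat (Suc m) * (nested_sum l (m + 2) (\<lambda>is. of_nat (prod_list is)) :: 'a::comm_semiring_1)"
  unfolding nested_sum_prod_list_Suc by simp

text \<open>
  The offset \<open>d = N - i\<close> is made explicit, since it governs the recursion: the two coefficients
  on the right have offsets \<open>d\<close> and \<open>d + 2\<close>.  Reading the absent $a_{-1}$ as \<open>0\<close> makes the
  boundary rule for $a_0$ an instance of the general one.
\<close>

lemma a_coeff_offset_step:
  "a_coeff n (n + (d + 2)) \<nu> =
     - of_nat (n + 1) * \<nu> * a_coeff (n + 1) (n + 1 + d) \<nu> +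
     (case n of 0 \<Rightarrow> 0 | Suc k \<Rightarrow> a_coeff k (k + (d + 2)) \<nu>)"
  by (cases n) simp_all

lemma a_coeff_even_offset:
  "a_coeff n (n + 2 * l) \<nu> =
     (- \<nu>) ^ l * nested_sum l (n + 1) (\<lambda>is. of_nat (prod_list is))"
proof (induction l arbitrary: n)
  case 0
  show ?case by (simp add: a_coeff_top)
next
  case (Suc l)
  note outer = this
  have offset: "2 * Suc l = 2 * l + 2" by simp
  \<comment> \<open>the outer hypothesis, used at \<open>n + 1\<close>, removes $a_{n+1}$; what is left is a recursion in \<open>n\<close> alone\<close>
  have step: "a_coeff n (n + 2 * Suc l) \<nu> =
      (- \<nu>) ^ Suc l * (of_nat (Suc n) * nested_sum l (n + 2) (\<lambda>is. of_nat (prod_list is))) +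
      (case n of 0 \<Rightarrow> 0 | Suc k \<Rightarrow> a_coeff k (k + 2 * Suc l) \<nu>)" for n
    unfolding offset a_coeff_offset_step[of n "2 * l" \<nu>] outer[of "n + 1"]
    by (simp add: mult_ac del: a_coeff.simps nested_sum.simps of_nat_Suc)
  show ?case
  proof (induction n)
    case 0
    have "nested_sum (Suc l) 0 (\<lambda>is. of_nat (prod_list is)) = (0 :: 'a)"
      by simp
    then show ?case
      unfolding step[of 0] using nested_sum_prod_list_Suc_Suc[of l 0, where 'a = 'a] by simp
  next
    case (Suc n)
    then show ?case
      unfolding step[of "Suc n"]
      using nested_sum_prod_list_Suc_Suc[of l "Suc n", where 'a = 'a]
      by (simp add: distrib_left del: nested_sum.simps a_coeff.simps)
  qed
qed

lemma a_coeff_odd_offset: "a_coeff n (n + (2 * l + 1)) \<nu> = 0"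
proof (induction l arbitrary: n)
  case 0
  show ?case by simp
next
  case (Suc l)
  note outer = this
  have offset: "2 * Suc l + 1 = 2 * l + 1 + 2" by simp
  have step: "a_coeff n (n + (2 * Suc l + 1)) \<nu> =
      (case n of 0 \<Rightarrow> 0 | Suc k \<Rightarrow> a_coeff k (k + (2 * Suc l + 1)) \<nu>)" for n
    unfolding offset a_coeff_offset_step[of n "2 * l + 1" \<nu>] outer[of "n + 1"]
    by (simp del: a_coeff.simps)
  show ?case
  proof (induction n)
    case 0
    show ?case by (subst step) simp
  next
    case (Suc n)
    then show ?case by (subst step) simp
  qed
qed

theorem theorem3:
  fixes \<nu> :: "'a::real_normed_field" and N :: nat
  shows "(\<forall>l::nat. 1 \<le> l \<and> int l \<le> \<lfloor>(real N - 1) / 2\<rfloor> \<longrightarrow>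
            a_coeff (N - 2 * l) N \<nu> =
              (- \<nu>) ^ l * nested_sum l (N - 2 * l + 1) (\<lambda>is. of_nat (prod_list is)))
       \<and> (\<forall>l::nat. 1 \<le> l \<and> int l \<le> \<lfloor>real N / 2\<rfloor> \<longrightarrow>
            a_coeff (N - (2 * l - 1)) N \<nu> = 0)"
proof (intro conjI allI impI; elim conjE)
  fix l :: nat
  assume "int l \<le> \<lfloor>(real N - 1) / 2\<rfloor>"
  then have "2 * l \<le> N" by (simp add: le_floor_iff)
  then show "a_coeff (N - 2 * l) N \<nu> =
      (- \<nu>) ^ l * nested_sum l (N - 2 * l + 1) (\<lambda>is. of_nat (prod_list is))"
    using a_coeff_even_offset[of "N - 2 * l" l \<nu>] by simp
next
  fix l :: nat
  assume "1 \<le> l" and "int l \<le> \<lfloor>real N / 2\<rfloor>"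
  then have "2 * l \<le> N" by (simp add: le_floor_iff)
  with \<open>1 \<le> l\<close> have "N - (2 * l - 1) + (2 * (l - 1) + 1) = N" by simp
  then show "a_coeff (N - (2 * l - 1)) N \<nu> = 0"
    using a_coeff_odd_offset[of "N - (2 * l - 1)" "l - 1" \<nu>] by metis
qed

end
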